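(* Let $h$ and $k$ be integers with $4\le h\le k-1$. Let $A=\{a_0,a_1,\ldots,a_{k-1}\}$ be a set of $k$ nonnegative integers with $0=a_0<a_1<\cdots<a_{k-1}$. Let $A_h=\{a_0,a_1,\ldots,a_h\}$ and $A'=A\setminus\{a_0\}$. Suppose that $\left|h^{\wedge}_{\pm}A\right|=2hk-h(h+1)+1$ and that one of the following conditions holds: (a) $A$ is an arithmetic progression; (b) $A_h$ is an arithmetic progression; (c) $\left|h^{\wedge}_{\pm}A_h\right|\ge h(h+1)+1$ and $4\le h\le k-3$; (d) $h^{\wedge}_{\pm}A=h^{\wedge}(-A')\cup h^{\wedge}_{\pm}A_h\cup h^{\wedge}A'$ and $A'$ is an arithmetic progression; (e) $\left|h^{\wedge}_{\pm}A_h\right|\ge h(h+1)+1$ and $A'$ is an arithmetic progression. Then $A=a_1\ast[0,k-1]$.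
   Context: For a positive integer $h$ and a finite set of integers $A=\{a_1,\ldots,a_k\}$ (distinct elements), the restricted $h$-fold signed sumset is $h^{\wedge}_{\pm}A=\left\{\sum_{i=1}^k\lambda_i a_i:\lambda_i\in\{-1,0,1\},\ \sum_{i=1}^k|\lambda_i|=h\right\}$, and the restricted $h$-fold sumset is $h^{\wedge}A=\left\{\sum_{i=1}^k\lambda_i a_i:\lambda_i\in\{0,1\},\ \sum_{i=1}^k\lambda_i=h\right\}$. For a set $S$ of integers, $-S=\{-s:s\in S\}$ and $c\ast S=\{cs:s\in S\}$ for an integer $c$. For integers $a\le b$, $[a,b]=\{n\in\mathbb{Z}:a\le n\le b\}$. *)

theory Defs
  imports Main
begin

(* Both sumsets are meant for finite A only. The coefficients are indexed by the elements
   of A, which amounts to an enumeration of A without repetition. *)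

definition restricted_signed_sumset :: "nat \<Rightarrow> int set \<Rightarrow> int set" where
  "restricted_signed_sumset h A =
     {(\<Sum>x\<in>A. l x * x) | l :: int \<Rightarrow> int.
        (\<forall>x\<in>A. l x \<in> {-1, 0, 1}) \<and> (\<Sum>x\<in>A. \<bar>l x\<bar>) = int h}"

definition restricted_sumset :: "nat \<Rightarrow> int set \<Rightarrow> int set" where
  "restricted_sumset h A =
     {(\<Sum>x\<in>A. l x * x) | l :: int \<Rightarrow> int.
        (\<forall>x\<in>A. l x \<in> {0, 1}) \<and> (\<Sum>x\<in>A. l x) = int h}"

definition dilate :: "int \<Rightarrow> int set \<Rightarrow> int set" where
  "dilate c S = (\<lambda>s. c * s) ` S"

(* For a set the order of the terms is immaterial, so the common difference d can be
   taken positive. *)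
definition arith_progression :: "int set \<Rightarrow> bool" where
  "arith_progression S \<longleftrightarrow>
     (\<exists>(x::int) (d::int) (n::nat). d > 0 \<and> n \<ge> 1 \<and> S = (\<lambda>i. x + int i * d) ` {..<n})"

end

theory Submission
  imports Defs
begin

text \<open>The signed sumset contains the restricted sumsets of A' and of its negative, and between
  them the signed sumset of the first h + 1 elements, consecutive parts meeting in one point.
  The part from A' has at least h (k - 1 - h) + 1 elements, since sums can be raised one index at
  a time; so the middle part has at most h (h + 1) + 1 elements. If A' is an arithmetic
  progression with difference d, a count of signed sums, by induction on h, shows that the middle
  part is larger than that unless its first term is d as well. If instead the middle part has
  at least h (h + 1) + 1 elements, then the part from A' is as small as possible,
  hence a sum depends only on the total of its indices; comparing sums
  that raise different indices shows that A' is an arithmetic progression. This fails for too few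
  elements, and in case (b) with k = h + 2 one more element of the middle region is used.\<close>

subsection \<open>Sumsets as sets of subset sums\<close>

lemma restricted_sumset_eq:
  assumes "finite A"
  shows "restricted_sumset h A = {\<Sum>P | P. P \<subseteq> A \<and> card P = h}"
proof (intro equalityI subsetI)
  fix s assume "s \<in> restricted_sumset h A"
  then obtain l where l: "\<And>x. x \<in> A \<Longrightarrow> l x \<in> {0, 1}" "(\<Sum>x\<in>A. l x) = int h"
    and s: "s = (\<Sum>x\<in>A. l x * x)"
    unfolding restricted_sumset_def by blast
  let ?P = "{x \<in> A. l x = 1}"
  have "s = (\<Sum>x\<in>A. if l x = 1 then x else 0)"
    unfolding s using l(1) by (intro sum.cong) auto
  then have "s = \<Sum>?P" by (simp add: sum.inter_filter[OF assms])
  moreover have "int h = (\<Sum>x\<in>A. if l x = 1 then 1 else 0)"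
    unfolding l(2)[symmetric] using l(1) by (intro sum.cong) auto
  then have "card ?P = h" by (simp add: sum.inter_filter[OF assms, symmetric])
  ultimately show "s \<in> {\<Sum>P | P. P \<subseteq> A \<and> card P = h}" by blast
next
  fix s assume "s \<in> {\<Sum>P | P. P \<subseteq> A \<and> card P = h}"
  then obtain P where P: "P \<subseteq> A" "card P = h" "s = \<Sum>P" by blast
  let ?l = "\<lambda>x. if x \<in> P then 1 else 0 :: int"
  have "s = (\<Sum>x\<in>A. ?l x * x)"
    unfolding P(3) by (rule sum.mono_neutral_cong_left[OF assms P(1)]) auto
  moreover have "(\<Sum>x\<in>A. ?l x) = int h"
    using P assms by (simp add: sum.If_cases Int_absorb1)
  ultimately show "s \<in> restricted_sumset h A"
    unfolding restricted_sumset_def by (intro CollectI exI[of _ ?l]) auto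
qed

text \<open>\<open>P\<close> and \<open>Q\<close> collect the elements with coefficient
  \<open>1\<close> and \<open>-1\<close>. Working with a pair of disjoint sets reduces every later
  construction to set operations.\<close>

lemma restricted_signed_sumset_eq:
  assumes "finite A"
  shows "restricted_signed_sumset h A =
    {\<Sum>P - \<Sum>Q | P Q. P \<subseteq> A \<and> Q \<subseteq> A \<and> P \<inter> Q = {} \<and> card P + card Q = h}" (is "_ = ?R")
proof (intro equalityI subsetI)
  fix s assume "s \<in> restricted_signed_sumset h A"
  then obtain l where l: "\<And>x. x \<in> A \<Longrightarrow> l x \<in> {-1, 0, 1}" "(\<Sum>x\<in>A. \<bar>l x\<bar>) = int h"
    and s: "s = (\<Sum>x\<in>A. l x * x)"
    unfolding restricted_signed_sumset_def by blast
  let ?P = "{x \<in> A. l x = 1}" and ?Q = "{x \<in> A. l x = - 1}"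
  have "s = (\<Sum>x\<in>A. (if l x = 1 then x else 0) - (if l x = - 1 then x else 0))"
    unfolding s using l(1) by (intro sum.cong) auto
  then have "s = \<Sum>?P - \<Sum>?Q" by (simp add: sum.inter_filter[OF assms] sum_subtractf)
  moreover have "int h = (\<Sum>x\<in>A. (if l x = 1 then 1 else 0) + (if l x = - 1 then 1 else 0))"
    unfolding l(2)[symmetric] using l(1) by (intro sum.cong) auto
  then have "int h = int (card ?P + card ?Q)"
    by (simp add: sum.inter_filter[OF assms, symmetric] sum.distrib)
  then have "card ?P + card ?Q = h" by linarith
  ultimately show "s \<in> ?R" by (intro CollectI exI[of _ ?P] exI[of _ ?Q]) auto
next
  fix s assume "s \<in> ?R"
  then obtain P Q where PQ: "P \<subseteq> A" "Q \<subseteq> A" "P \<inter> Q = {}" "card P + card Q = h"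
    "s = \<Sum>P - \<Sum>Q" by blast
  let ?p = "\<lambda>x. if x \<in> P then 1 else 0 :: int" and ?q = "\<lambda>x. if x \<in> Q then 1 else 0 :: int"
  have "(\<Sum>x\<in>A. ?p x * x) = \<Sum>P" "(\<Sum>x\<in>A. ?q x * x) = \<Sum>Q"
    by (rule sum.mono_neutral_cong_right[OF assms PQ(1)]; auto)
      (rule sum.mono_neutral_cong_right[OF assms PQ(2)]; auto)
  then have "s = (\<Sum>x\<in>A. (?p x - ?q x) * x)"
    unfolding PQ(5) by (simp add: left_diff_distrib sum_subtractf)
  moreover have "(\<Sum>x\<in>A. \<bar>?p x - ?q x\<bar>) = (\<Sum>x\<in>A. ?p x + ?q x)"
    using PQ(3) by (intro sum.cong) auto
  then have "(\<Sum>x\<in>A. \<bar>?p x - ?q x\<bar>) = int h"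
    using PQ assms by (simp add: sum.distrib sum.If_cases Int_absorb1)
  ultimately show "s \<in> restricted_signed_sumset h A"
    unfolding restricted_signed_sumset_def
    by (intro CollectI exI[of _ "\<lambda>x. ?p x - ?q x"]) auto
qed

text \<open>The rank arguments move one index at a time and measure an index set \<open>I\<close> by
  its total \<open>\<Sum>I\<close>, so sums have to be indexed by sets of positions rather than of
  values.\<close>

lemma restricted_sumset_image:
  fixes b :: "nat \<Rightarrow> int"
  assumes "inj_on b {..<n}"
  shows "restricted_sumset h (b ` {..<n}) = {sum b I | I. I \<subseteq> {..<n} \<and> card I = h}"
proof -
  have "\<Sum>(b ` I) = sum b I" "card (b ` I) = card I" if "I \<subseteq> {..<n}" for I
    using inj_on_subset[OF assms that] by (auto simp: sum.reindex card_image)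
  then show ?thesis
    unfolding restricted_sumset_eq[OF finite_imageI[OF finite_lessThan]] subset_image_iff
    by (smt (verit, ccfv_SIG) Collect_cong)
qed

lemma finite_restricted_sumset:
  assumes "finite A" shows "finite (restricted_sumset h A)"
proof -
  have "restricted_sumset h A \<subseteq> sum (\<lambda>x. x) ` Pow A"
    unfolding restricted_sumset_eq[OF assms] by auto
  then show ?thesis by (rule finite_subset) (use assms in auto)
qed

lemma finite_restricted_signed_sumset:
  assumes "finite A" shows "finite (restricted_signed_sumset h A)"
proof -
  have "restricted_signed_sumset h A \<subseteq> (\<lambda>(P, Q). \<Sum>P - \<Sum>Q) ` (Pow A \<times> Pow A)"
    unfolding restricted_signed_sumset_eq[OF assms] by auto
  then show ?thesis by (rule finite_subset) (use assms in auto)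
qed

lemma restricted_signed_sumset_mono:
  assumes "finite A" "B \<subseteq> A"
  shows "restricted_signed_sumset h B \<subseteq> restricted_signed_sumset h A"
  unfolding restricted_signed_sumset_eq[OF assms(1)]
    restricted_signed_sumset_eq[OF finite_subset[OF assms(2,1)]]
  using assms(2) by blast

lemma restricted_sumset_subset_signed:
  assumes "finite A" "B \<subseteq> A"
  shows "restricted_sumset h B \<subseteq> restricted_signed_sumset h A"
proof
  fix s assume "s \<in> restricted_sumset h B"
  then obtain P where "P \<subseteq> B" "card P = h" "s = \<Sum>P"
    using restricted_sumset_eq[OF finite_subset[OF assms(2,1)]] by auto
  then show "s \<in> restricted_signed_sumset h A"
    unfolding restricted_signed_sumset_eq[OF assms(1)] using assms(2)
    by (intro CollectI exI[of _ P] exI[of _ "{}"]) auto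
qed

lemma restricted_signed_sumset_uminus:
  assumes "finite A" "s \<in> restricted_signed_sumset h A"
  shows "- s \<in> restricted_signed_sumset h A"
proof -
  obtain P Q where "P \<subseteq> A" "Q \<subseteq> A" "P \<inter> Q = {}" "card P + card Q = h" "s = \<Sum>P - \<Sum>Q"
    using assms restricted_signed_sumset_eq by auto
  then show ?thesis unfolding restricted_signed_sumset_eq[OF assms(1)]
    by (intro CollectI exI[of _ Q] exI[of _ P]) auto
qed

lemma restricted_signed_sumset_abs_le:
  assumes "finite A" "\<And>x. x \<in> A \<Longrightarrow> 0 \<le> x" "s \<in> restricted_signed_sumset h A"
  shows "\<bar>s\<bar> \<le> \<Sum>A"
proof -
  obtain P Q where PQ: "P \<subseteq> A" "Q \<subseteq> A" "s = \<Sum>P - \<Sum>Q"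
    using assms restricted_signed_sumset_eq by auto
  have "0 \<le> \<Sum>P" "\<Sum>P \<le> \<Sum>A" "0 \<le> \<Sum>Q" "\<Sum>Q \<le> \<Sum>A"
    using PQ assms by (auto intro!: sum_nonneg sum_mono2)
  then show ?thesis using PQ by linarith
qed

subsection \<open>Ranks in the restricted sumset\<close>

text \<open>Without such a step \<open>I\<close> is closed downwards, and a finite downward closed
  set is an initial segment. Hence any index set can be lowered by unit moves until it is
  \<open>{..<h}\<close>.\<close>

lemma exists_down_step:
  fixes I :: "nat set"
  assumes "finite I" "I \<noteq> {..<card I}"
  shows "\<exists>i. i \<notin> I \<and> Suc i \<in> I"
proof (rule ccontr)
  assume "\<not> ?thesis"
  then have step: "i \<in> I" if "Suc i \<in> I" for i using that by blast
  have down: "j \<in> I" if "i \<in> I" "j \<le> i" for i j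
    using that(2,1) by (induction j rule: inc_induct) (auto dest: step)
  have "I \<subseteq> {..<card I}"
  proof
    fix i assume "i \<in> I"
    then have "{..i} \<subseteq> I" using down by blast
    then have "card {..i} \<le> card I" by (rule card_mono[OF assms(1)])
    then show "i \<in> {..<card I}" by simp
  qed
  then show False using assms(2) card_subset_eq[of "{..<card I}" I] by simp
qed

text \<open>Mirror image: without such a step \<open>I\<close> is closed upwards inside
  \<open>{..<n}\<close>, hence a final segment.\<close>

lemma exists_up_step:
  fixes I :: "nat set"
  assumes "I \<subseteq> {..<n}" "I \<noteq> {n - card I..<n}"
  shows "\<exists>i. i \<in> I \<and> Suc i \<notin> I \<and> Suc i < n"
proof (rule ccontr)
  assume "\<not> ?thesis"
  then have step: "Suc i \<in> I" if "i \<in> I" "Suc i < n" for i using that by blast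
  have up: "j \<in> I" if "i \<in> I" "i \<le> j" "j < n" for i j
    using that(2,1,3) by (induction j rule: dec_induct) (auto intro: step)
  have fin: "finite I" by (rule finite_subset[OF assms(1)]) simp
  have "I \<subseteq> {n - card I..<n}"
  proof
    fix i assume i: "i \<in> I"
    then have "{i..<n} \<subseteq> I" using up by auto
    then have "card {i..<n} \<le> card I" by (rule card_mono[OF fin])
    then show "i \<in> {n - card I..<n}" using i assms(1) by auto
  qed
  moreover have "card I \<le> n" using card_mono[OF _ assms(1)] by simp
  ultimately show False using assms(2) card_subset_eq[of "{n - card I..<n}" I] by simp
qed

text \<open>Group-valued, so that it serves both for \<open>b\<close> and for \<open>int\<close>;
  the latter tracks the index total.\<close>

lemma sum_swap:
  fixes f :: "nat \<Rightarrow> 'a :: ab_group_add"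
  assumes "finite I" "i \<in> I" "j \<notin> I"
  shows "sum f (insert j (I - {i})) = sum f I - f i + f j"
    and "card (insert j (I - {i})) = card I"
proof -
  show "sum f (insert j (I - {i})) = sum f I - f i + f j"
    using assms by (simp add: sum_diff1)
  show "card (insert j (I - {i})) = card I"
  proof -
    have "card I = Suc (card (I - {i}))" by (rule card.remove[OF assms(1,2)])
    moreover have "card (insert j (I - {i})) = Suc (card (I - {i}))"
      using assms(1,3) by (intro card_insert_disjoint) auto
    ultimately show ?thesis by simp
  qed
qed

text \<open>A unit move downwards lowers the index total by exactly one and the sum strictly, so the
  new sum is one further element below. The induction follows such moves down to
  \<open>{..<h}\<close>.\<close>

lemma sum_rank_ge:
  fixes b :: "nat \<Rightarrow> int"
  assumes mono: "strict_mono_on {..<n} b" and "I \<subseteq> {..<n}" "card I = h"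
  shows "sum b {..<h} \<le> sum b I"
    and "int (\<Sum>I) - int (\<Sum>{..<h}) \<le> int (card {s \<in> restricted_sumset h (b ` {..<n}). s < sum b I})"
proof -
  let ?S = "restricted_sumset h (b ` {..<n})"
  have inj: "inj_on b {..<n}" by (rule strict_mono_on_imp_inj_on[OF mono])
  have finS: "finite ?S" by (rule finite_restricted_sumset) simp
  have "sum b {..<h} \<le> sum b I \<and>
    int (\<Sum>I) - int (\<Sum>{..<h}) \<le> int (card {s \<in> ?S. s < sum b I})"
    using assms(2,3)
  proof (induction "\<Sum>I" arbitrary: I rule: less_induct)
    case less
    have fin: "finite I" by (rule finite_subset[OF less.prems(1)]) simp
    show ?case
    proof (cases "I = {..<h}")
      case False
      then obtain i where i: "i \<notin> I" "Suc i \<in> I"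
        using exists_down_step[OF fin] less.prems(2) by blast
      let ?J = "insert i (I - {Suc i})"
      have J: "?J \<subseteq> {..<n}" "card ?J = h"
        using less.prems i sum_swap(2)[OF fin i(2,1)] by auto
      have SJ: "int (\<Sum>?J) = int (\<Sum>I) - 1"
        using sum_swap(1)[OF fin i(2,1), of int] by simp
      then have IH: "sum b {..<h} \<le> sum b ?J"
        "int (\<Sum>?J) - int (\<Sum>{..<h}) \<le> int (card {s \<in> ?S. s < sum b ?J})"
        using less.hyps[OF _ J] by linarith+
      have lt: "sum b ?J < sum b I"
        using sum_swap(1)[OF fin i(2,1), of b] strict_mono_onD[OF mono, of i "Suc i"] i less.prems(1)
        by auto
      have "sum b ?J \<in> ?S" unfolding restricted_sumset_image[OF inj] using J by blast
      then have "insert (sum b ?J) {s \<in> ?S. s < sum b ?J} \<subseteq> {s \<in> ?S. s < sum b I}"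
        using lt by auto
      then have "card (insert (sum b ?J) {s \<in> ?S. s < sum b ?J}) \<le> card {s \<in> ?S. s < sum b I}"
        using finS by (intro card_mono) auto
      then show ?thesis using IH lt finS SJ by simp
    qed simp
  qed
  then show "sum b {..<h} \<le> sum b I"
    and "int (\<Sum>I) - int (\<Sum>{..<h}) \<le> int (card {s \<in> ?S. s < sum b I})" by auto
qed

text \<open>The same argument with unit moves upwards, ending at the \<open>h\<close> largest
  indices.\<close>

lemma sum_corank_ge:
  fixes b :: "nat \<Rightarrow> int"
  assumes mono: "strict_mono_on {..<n} b" and "I \<subseteq> {..<n}" "card I = h"
  shows "int (\<Sum>{n - h..<n}) - int (\<Sum>I) \<le> int (card {s \<in> restricted_sumset h (b ` {..<n}). sum b I < s})"
proof -
  let ?S = "restricted_sumset h (b ` {..<n})"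
  have inj: "inj_on b {..<n}" by (rule strict_mono_on_imp_inj_on[OF mono])
  have finS: "finite ?S" by (rule finite_restricted_sumset) simp
  \<comment> \<open>A crude bound on index totals; it guarantees that the truncated difference
    \<open>n * n - \<Sum>I\<close> really drops when an index is raised.\<close>
  have bound: "\<Sum>I \<le> n * n" if "I \<subseteq> {..<n}" for I
  proof -
    have "\<Sum>I \<le> card I * n" using sum_bounded_above[of I "\<lambda>x. x" n] that by fastforce
    also have "card I \<le> n" using card_mono[OF _ that] by simp
    finally show ?thesis by simp
  qed
  show ?thesis using assms(2,3)
  proof (induction "n * n - \<Sum>I" arbitrary: I rule: less_induct)
    case less
    have fin: "finite I" by (rule finite_subset[OF less.prems(1)]) simp
    show ?case
    proof (cases "I = {n - h..<n}")
      case False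
      then obtain i where i: "i \<in> I" "Suc i \<notin> I" "Suc i < n"
        using exists_up_step[OF less.prems(1)] less.prems(2) by blast
      let ?J = "insert (Suc i) (I - {i})"
      have J: "?J \<subseteq> {..<n}" "card ?J = h"
        using less.prems i sum_swap(2)[OF fin i(1,2)] by auto
      have SJ: "int (\<Sum>?J) = int (\<Sum>I) + 1"
        using sum_swap(1)[OF fin i(1,2), of int] by simp
      have "n * n - \<Sum>?J < n * n - \<Sum>I" using SJ bound[OF J(1)] by linarith
      then have IH: "int (\<Sum>{n - h..<n}) - int (\<Sum>?J) \<le> int (card {s \<in> ?S. sum b ?J < s})"
        using less.hyps[OF _ J] by auto
      have lt: "sum b I < sum b ?J"
        using sum_swap(1)[OF fin i(1,2), of b] strict_mono_onD[OF mono, of i "Suc i"] i by auto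
      have "sum b ?J \<in> ?S" unfolding restricted_sumset_image[OF inj] using J by blast
      then have "insert (sum b ?J) {s \<in> ?S. sum b ?J < s} \<subseteq> {s \<in> ?S. sum b I < s}"
        using lt by auto
      then have "card (insert (sum b ?J) {s \<in> ?S. sum b ?J < s}) \<le> card {s \<in> ?S. sum b I < s}"
        using finS by (intro card_mono) auto
      then show ?thesis using IH lt finS SJ by simp
    qed simp
  qed
qed

text \<open>The number of unit moves from the lowest to the highest index set is
  \<open>h * (n - h)\<close>; this is the source of the bound on the size of the sumset.\<close>

lemma sum_top_block:
  fixes h n :: nat
  assumes "h \<le> n"
  shows "\<Sum>{n - h..<n} = \<Sum>{..<h} + h * (n - h)"
proof -
  have "\<Sum>{n - h..<n} = (\<Sum>i<h. i + (n - h))"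
    by (rule sum.reindex_bij_witness[of _ "\<lambda>i. i + (n - h)" "\<lambda>i. i - (n - h)"])
      (use assms in auto)
  then show ?thesis by (simp add: sum.distrib)
qed

section \<open>The least size of a restricted sumset, and what attaining it forces\<close>

lemma card_split_at:
  assumes "finite S" "(x :: int) \<in> S"
  shows "card S = card {s \<in> S. s < x} + card {s \<in> S. x < s} + 1"
proof -
  have "S = insert x ({s \<in> S. s < x} \<union> {s \<in> S. x < s})" using assms(2) by auto
  then have "card S = card (insert x ({s \<in> S. s < x} \<union> {s \<in> S. x < s}))" by simp
  also have "\<dots> = card ({s \<in> S. s < x} \<union> {s \<in> S. x < s}) + 1" using assms(1) by simp
  also have "card ({s \<in> S. s < x} \<union> {s \<in> S. x < s}) = card {s \<in> S. s < x} + card {s \<in> S. x < s}"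
    using assms(1) by (intro card_Un_disjoint) auto
  finally show ?thesis by simp
qed

text \<open>The corank bound at \<open>{..<h}\<close> supplies \<open>h * (n - h)\<close> sums above
  the lowest one.\<close>

lemma card_restricted_sumset_ge:
  fixes b :: "nat \<Rightarrow> int"
  assumes mono: "strict_mono_on {..<n} b" and "h \<le> n"
  shows "h * (n - h) + 1 \<le> card (restricted_sumset h (b ` {..<n}))"
proof -
  let ?S = "restricted_sumset h (b ` {..<n})"
  have h: "{..<h} \<subseteq> {..<n}" "card {..<h} = h" using assms(2) by auto
  have finS: "finite ?S" by (rule finite_restricted_sumset) simp
  have mem: "sum b {..<h} \<in> ?S"
    unfolding restricted_sumset_image[OF strict_mono_on_imp_inj_on[OF mono]] using h by blast
  show ?thesis
    using card_split_at[OF finS mem] sum_corank_ge[OF mono h]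
      sum_top_block[OF assms(2)] by linarith
qed

text \<open>Every maximal chain of index sets enumerates the whole minimal sumset, so the value
  of a sum is determined by the height of its index set.\<close>

lemma minimal_sum_eq:
  fixes b :: "nat \<Rightarrow> int"
  assumes mono: "strict_mono_on {..<n} b" and "h \<le> n"
    and min: "card (restricted_sumset h (b ` {..<n})) \<le> h * (n - h) + 1"
    and I: "I \<subseteq> {..<n}" "card I = h" and J: "J \<subseteq> {..<n}" "card J = h" and eq: "\<Sum>I = \<Sum>J"
  shows "sum b I = sum b J"
proof -
  let ?S = "restricted_sumset h (b ` {..<n})"
  have finS: "finite ?S" by (rule finite_restricted_sumset) simp
  have mem: "sum b I \<in> ?S" "sum b J \<in> ?S"
    unfolding restricted_sumset_image[OF strict_mono_on_imp_inj_on[OF mono]] using I J by auto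
  \<comment> \<open>The lower bounds for rank and corank add up to \<open>h * (n - h)\<close>, which
    is all that \<open>min\<close> leaves besides the sum itself; so both are equalities.\<close>
  have "int (card {s \<in> ?S. s < sum b I}) = int (\<Sum>I) - int (\<Sum>{..<h})"
    using card_split_at[OF finS mem(1)] sum_corank_ge[OF mono I]
      sum_rank_ge(2)[OF mono I] sum_top_block[OF assms(2)] min by linarith
  moreover have "int (card {s \<in> ?S. s < sum b J}) = int (\<Sum>J) - int (\<Sum>{..<h})"
    using card_split_at[OF finS mem(2)] sum_corank_ge[OF mono J]
      sum_rank_ge(2)[OF mono J] sum_top_block[OF assms(2)] min by linarith
  ultimately have card_eq: "card {s \<in> ?S. s < sum b I} = card {s \<in> ?S. s < sum b J}"
    using eq by simp
  have "\<not> x < y" if "x \<in> ?S" "card {s \<in> ?S. s < x} = card {s \<in> ?S. s < y}" for x y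
  proof
    assume "x < y"
    then have "{s \<in> ?S. s < x} \<subset> {s \<in> ?S. s < y}" using that(1) by force
    moreover have "finite {s \<in> ?S. s < y}" using finS by simp
    ultimately have "card {s \<in> ?S. s < x} < card {s \<in> ?S. s < y}" by (rule psubset_card_mono[rotated])
    then show False using that(2) by simp
  qed
  from this[OF mem(1) card_eq] this[OF mem(2) card_eq[symmetric]] show ?thesis by simp
qed

text \<open>Raising \<open>i\<close> and raising \<open>j\<close> in the index set
  \<open>{i, j} \<union> K\<close> lead to the same index total, hence to the same sum. The distance
  between \<open>i\<close> and \<open>j\<close> keeps the four indices distinct, and
  \<open>h + 2 \<le> n\<close> leaves room for the \<open>h - 2\<close> indices of
  \<open>K\<close>.\<close>

lemma minimal_gaps_eq:
  fixes b :: "nat \<Rightarrow> int"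
  assumes mono: "strict_mono_on {..<n} b" and h: "2 \<le> h" "h + 2 \<le> n"
    and min: "card (restricted_sumset h (b ` {..<n})) \<le> h * (n - h) + 1"
    and ij: "i + 2 \<le> j" "Suc j < n"
  shows "b (Suc i) - b i = b (Suc j) - b j"
proof -
  let ?E = "{i, Suc i, j, Suc j}"
  have "card ({..<n} - ?E) = n - 4"
    using ij by (subst card_Diff_subset) auto
  then have "h - 2 \<le> card ({..<n} - ?E)" using h by simp
  then obtain K where K: "K \<subseteq> {..<n} - ?E" "card K = h - 2" "finite K"
    using obtain_subset_with_card_n[of "h - 2" "{..<n} - ?E"] by blast
  let ?I = "insert (Suc i) (insert j K)" and ?J = "insert i (insert (Suc j) K)"
  have notin: "i \<notin> K" "Suc i \<notin> K" "j \<notin> K" "Suc j \<notin> K" using K(1) by auto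
  have "sum b ?I = sum b ?J"
  proof (rule minimal_sum_eq[OF mono _ min])
    show "?I \<subseteq> {..<n}" "?J \<subseteq> {..<n}" using K(1) ij by auto
    show "card ?I = h" "card ?J = h" using K notin ij h by auto
    show "\<Sum>?I = \<Sum>?J" using K notin ij by auto
  qed (use h in simp)
  moreover have "sum b ?I = b (Suc i) + b j + sum b K" "sum b ?J = b i + b (Suc j) + sum b K"
    using K notin ij by auto
  ultimately show ?thesis by simp
qed

lemma linear_of_gaps:
  fixes b :: "nat \<Rightarrow> int"
  assumes "\<And>i. Suc i < n \<Longrightarrow> b (Suc i) - b i = d" "i < n"
  shows "b i = b 0 + int i * d"
  using assms(2)
proof (induction i)
  case (Suc i)
  then show ?case using assms(1)[of i] by (simp add: algebra_simps)
qed simp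

text \<open>Neighbouring gaps cannot be compared directly. Gap \<open>0\<close> equals every gap
  from \<open>2\<close> on, and gap \<open>1\<close> is reached through gap \<open>3\<close>, which
  exists because \<open>5 \<le> n\<close>.\<close>

lemma minimal_imp_linear:
  fixes b :: "nat \<Rightarrow> int"
  assumes mono: "strict_mono_on {..<n} b" and h: "2 \<le> h" "h + 2 \<le> n" "5 \<le> n"
    and min: "card (restricted_sumset h (b ` {..<n})) \<le> h * (n - h) + 1"
    and "i < n"
  shows "b i = b 0 + int i * (b 1 - b 0)"
proof (rule linear_of_gaps[OF _ assms(6)])
  fix i assume i: "Suc i < n"
  note gap = minimal_gaps_eq[OF mono h(1,2) min]
  consider "i = 0" | "i = 1" | "2 \<le> i" by linarith
  then show "b (Suc i) - b i = b 1 - b 0"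
    using gap[of 0 i] gap[of 0 3] gap[of 1 3] i h(3) by cases auto
qed

section \<open>Increasing enumerations of arithmetic progressions\<close>

lemma strict_mono_on_image_eq:
  fixes f g :: "nat \<Rightarrow> int"
  assumes "strict_mono_on {..<n} f" "strict_mono_on {..<n} g" "f ` {..<n} = g ` {..<n}" "i < n"
  shows "f i = g i"
proof -
  have *: "sorted (map f [0..<n]) \<and> distinct (map f [0..<n])" if "strict_mono_on {..<n} f"
    for f :: "nat \<Rightarrow> int"
    using that strict_mono_on_imp_inj_on[OF that]
    by (auto simp: sorted_iff_nth_mono distinct_map atLeast0LessThan
        intro: strict_mono_on_leD[OF that])
  have "map f [0..<n] = map g [0..<n]"
    by (rule sorted_distinct_set_unique) (use * assms in \<open>auto simp: atLeast0LessThan\<close>)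
  then show ?thesis using assms(4) by (simp add: list_eq_iff_nth_eq)
qed

text \<open>The enumeration supplied by the definition is increasing since \<open>d > 0\<close>, and
  a finite set has only one increasing enumeration, so it agrees with \<open>b\<close>.\<close>

lemma arith_progression_image:
  fixes b :: "nat \<Rightarrow> int"
  assumes mono: "strict_mono_on {..<n} b" and "arith_progression (b ` {..<n})"
  obtains d where "d > 0" "\<And>i. i < n \<Longrightarrow> b i = b 0 + int i * d"
proof -
  obtain x d m where d: "d > 0" "b ` {..<n} = (\<lambda>i::nat. x + int i * d) ` {..<m}"
    using assms(2) unfolding arith_progression_def by blast
  let ?g = "\<lambda>i::nat. x + int i * d"
  have mono': "strict_mono_on A ?g" for A
    using d(1) by (auto intro!: strict_mono_onI)
  have "card (b ` {..<n}) = n" "card (?g ` {..<m}) = m"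
    using strict_mono_on_imp_inj_on[OF mono] strict_mono_on_imp_inj_on[OF mono', of "{..<m}"]
    by (auto simp: card_image)
  then have "m = n" using d(2) by simp
  then have *: "b i = ?g i" if "i < n" for i
    using strict_mono_on_image_eq[OF mono mono' _ that] d(2) by simp
  show thesis
  proof (rule that[OF d(1)])
    fix i assume "i < n"
    then show "b i = b 0 + int i * d" using *[of i] *[of 0] by simp
  qed
qed

subsection \<open>Signed sums of an arithmetic progression\<close>

text \<open>Subtracted from the sum of B, these are signed sums of B together with 0, using as many
  terms as B has elements: coefficients 0 and 2 become signs, and the element with
  coefficient 1, of which there is at most one, is replaced by 0.\<close>

definition defect_sums :: "int set \<Rightarrow> int set" where
  "defect_sums B = {2 * \<Sum>P | P. P \<subseteq> B} \<union> {2 * \<Sum>P + r | P r. r \<in> B \<and> P \<subseteq> B - {r}}"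

lemma finite_defect_sums:
  assumes "finite B" shows "finite (defect_sums B)"
proof -
  have "defect_sums B \<subseteq> (\<lambda>P. 2 * \<Sum>P) ` Pow B \<union> (\<lambda>(P, r). 2 * \<Sum>P + r) ` (Pow B \<times> B)"
    unfolding defect_sums_def by auto
  then show ?thesis by (rule finite_subset) (use assms in auto)
qed

lemma defect_sums_mono: "B \<subseteq> C \<Longrightarrow> defect_sums B \<subseteq> defect_sums C"
  unfolding defect_sums_def by blast

lemma defect_sums_evenI: "P \<subseteq> B \<Longrightarrow> 2 * \<Sum>P \<in> defect_sums B"
  unfolding defect_sums_def by blast

lemma defect_sums_oddI: "P \<subseteq> B \<Longrightarrow> r \<in> B \<Longrightarrow> r \<notin> P \<Longrightarrow> 2 * \<Sum>P + r \<in> defect_sums B"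
  unfolding defect_sums_def by blast

lemma defect_sums_le:
  assumes "finite B" "\<And>x. x \<in> B \<Longrightarrow> 0 \<le> x" "y \<in> defect_sums B"
  shows "y \<le> 2 * \<Sum>B"
proof -
  from assms(3) consider P where "P \<subseteq> B" "y = 2 * \<Sum>P"
    | P r where "r \<in> B" "P \<subseteq> B - {r}" "y = 2 * \<Sum>P + r"
    unfolding defect_sums_def by blast
  then show ?thesis
  proof cases
    case 1
    then show ?thesis using sum_mono2[OF assms(1) 1(1), of "\<lambda>x. x"] assms(2)
      by (auto intro!: sum_nonneg)
  next
    case 2
    have "\<Sum>P \<le> \<Sum>(B - {r})" "0 \<le> \<Sum>P" "0 \<le> r"
      using 2 assms by (auto intro!: sum_nonneg sum_mono2)
    moreover have "\<Sum>B = r + \<Sum>(B - {r})" using assms(1) 2(1) by (rule sum.remove)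
    ultimately show ?thesis using 2 by linarith
  qed
qed

text \<open>Replacing each coefficient by its difference from \<open>2\<close> complements
  \<open>P\<close> and keeps the coefficient \<open>1\<close> of \<open>r\<close>.\<close>

lemma defect_sums_reflect:
  assumes "finite B" "y \<in> defect_sums B"
  shows "2 * \<Sum>B - y \<in> defect_sums B"
proof -
  from assms(2) consider P where "P \<subseteq> B" "y = 2 * \<Sum>P"
    | P r where "r \<in> B" "P \<subseteq> B - {r}" "y = 2 * \<Sum>P + r"
    unfolding defect_sums_def by blast
  then show ?thesis
  proof cases
    case 1
    then have "2 * \<Sum>B - y = 2 * \<Sum>(B - P)" using assms(1) by (simp add: sum_diff)
    then show ?thesis using defect_sums_evenI[of "B - P" B] by auto
  next
    case 2
    have "\<Sum>B = r + \<Sum>(B - {r})" using assms(1) 2(1) by (rule sum.remove)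
    moreover have "\<Sum>(B - {r} - P) = \<Sum>(B - {r}) - \<Sum>P" using assms(1) 2 by (simp add: sum_diff)
    ultimately have "2 * \<Sum>B - y = 2 * \<Sum>(B - {r} - P) + r" using 2(3) by simp
    then show ?thesis using defect_sums_oddI[of "B - {r} - P" B r] 2(1) by (metis Diff_iff Diff_subset insertI1 subset_trans)
  qed
qed

lemma card_defect_sums_le:
  assumes "finite B" "0 \<notin> B"
  shows "card (defect_sums B) \<le> card (restricted_signed_sumset (card B) (insert 0 B))"
proof -
  let ?R = "restricted_signed_sumset (card B) (insert 0 B)"
  have fin: "finite (insert 0 B)" using assms(1) by simp
  have "(\<lambda>y. \<Sum>B - y) ` defect_sums B \<subseteq> ?R"
  proof
    fix s assume "s \<in> (\<lambda>y. \<Sum>B - y) ` defect_sums B"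
    then consider P where "P \<subseteq> B" "s = \<Sum>B - 2 * \<Sum>P"
      | P r where "r \<in> B" "P \<subseteq> B - {r}" "s = \<Sum>B - (2 * \<Sum>P + r)"
      unfolding defect_sums_def by blast
    then obtain P Q where "P \<subseteq> insert 0 B" "Q \<subseteq> insert 0 B" "P \<inter> Q = {}"
      "card P + card Q = card B" "s = \<Sum>P - \<Sum>Q"
    proof cases
      case 1
      show thesis
      proof (rule that[of "B - P" P])
        have "card P \<le> card B" using 1 assms(1) by (intro card_mono)
        then show "card (B - P) + card P = card B"
          using 1 assms(1) finite_subset by (subst card_Diff_subset) auto
        show "s = \<Sum>(B - P) - \<Sum>P" using 1 assms(1) by (simp add: sum_diff)
      qed (use 1 in auto)
    next
      case 2
      let ?Q = "insert 0 (B - {r} - P)"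
      have finP: "finite P" using 2 assms(1) finite_subset by blast
      have fin': "finite (B - {r} - P)" using assms(1) by simp
      have c: "card B = Suc (card (B - {r}))" by (rule card.remove[OF assms(1) 2(1)])
      have le: "card P \<le> card (B - {r})" using 2 assms(1) by (intro card_mono) auto
      have d: "card (B - {r} - P) = card (B - {r}) - card P"
        by (rule card_Diff_subset[OF finP 2(2)])
      have e: "\<Sum>B = r + \<Sum>(B - {r})" using assms(1) 2(1) by (rule sum.remove)
      have f: "\<Sum>(B - {r} - P) = \<Sum>(B - {r}) - \<Sum>P" using assms(1) 2 by (simp add: sum_diff)
      show thesis
      proof (rule that[of ?Q P])
        show "card ?Q + card P = card B" using fin' assms(2) c d le by simp
        show "s = \<Sum>?Q - \<Sum>P" using 2(3) e f fin' assms(2) by simp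
        show "?Q \<inter> P = {}" using 2 assms(2) by auto
      qed (use 2 in auto)
    qed
    then show "s \<in> ?R" unfolding restricted_signed_sumset_eq[OF fin] by blast
  qed
  then have "card ((\<lambda>y. \<Sum>B - y) ` defect_sums B) \<le> card ?R"
    by (rule card_mono[OF finite_restricted_signed_sumset[OF fin]])
  moreover have "inj_on (\<lambda>y. \<Sum>B - y) (defect_sums B)" by (auto intro: inj_onI)
  ultimately show ?thesis by (simp add: card_image)
qed

text \<open>Reflecting a sum below \<open>2 * b\<close> puts it above \<open>2 * \<Sum>B\<close>,
  which bounds all defect sums of \<open>B\<close>. So every element of \<open>N\<close> accounts
  for a new sum, even if it is itself a defect sum of \<open>B\<close>.\<close>

lemma card_defect_sums_insert:
  assumes "finite B" "b \<notin> B" "\<And>x. x \<in> insert b B \<Longrightarrow> 0 \<le> x"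
    and N: "N \<subseteq> defect_sums (insert b B)" "\<And>y. y \<in> N \<Longrightarrow> y < 2 * b"
  shows "card (defect_sums B) + card N \<le> card (defect_sums (insert b B))"
proof -
  let ?f = "\<lambda>y. 2 * \<Sum>(insert b B) - y"
  have fin: "finite (insert b B)" using assms(1) by simp
  have "2 * \<Sum>B < ?f y" if "y \<in> N" for y using N(2)[OF that] assms(1,2) by simp
  then have "defect_sums B \<inter> ?f ` N = {}" using defect_sums_le[OF assms(1)] assms(3) by force
  moreover have sub: "?f ` N \<subseteq> defect_sums (insert b B)" using N(1) defect_sums_reflect[OF fin] by blast
  moreover have "card (?f ` N) = card N" by (intro card_image) (auto intro: inj_onI)
  ultimately have "card (defect_sums B \<union> ?f ` N) = card (defect_sums B) + card N"
    using finite_defect_sums[OF assms(1)] finite_subset[OF sub finite_defect_sums[OF fin]]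
    by (simp add: card_Un_disjoint)
  moreover have "card (defect_sums B \<union> ?f ` N) \<le> card (defect_sums (insert b B))"
    using sub defect_sums_mono[of B "insert b B"]
    by (intro card_mono finite_defect_sums[OF fin]) auto
  ultimately show ?thesis by simp
qed

section \<open>Counting defect sums of a progression with first term \<open>c\<close> and difference
  \<open>d\<close>\<close>

context
  fixes c d :: int
  assumes c: "0 < c" and d: "0 < d"
begin

abbreviation (input) ap :: "nat \<Rightarrow> int set" where
  "ap h \<equiv> (\<lambda>i. c + int i * d) ` {..<h}"

text \<open>For a progression, only the size and the index total of \<open>P\<close> matter.\<close>

lemma defect_sums_apI:
  assumes "P \<subseteq> {..<h}"
  shows "2 * (int (card P) * c + int (\<Sum>P) * d) \<in> defect_sums (ap h)"
    and "i < h \<Longrightarrow> i \<notin> P \<Longrightarrow>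
      2 * (int (card P) * c + int (\<Sum>P) * d) + (c + int i * d) \<in> defect_sums (ap h)"
proof -
  have inj: "inj_on (\<lambda>i. c + int i * d) X" for X using d by (auto intro!: inj_onI)
  have *: "\<Sum>((\<lambda>i. c + int i * d) ` P) = int (card P) * c + int (\<Sum>P) * d"
    using sum_distrib_right[of int P d]
    by (simp add: sum.reindex[OF inj] sum.distrib)
  show "2 * (int (card P) * c + int (\<Sum>P) * d) \<in> defect_sums (ap h)"
    unfolding *[symmetric] using assms by (intro defect_sums_evenI image_mono)
  show "2 * (int (card P) * c + int (\<Sum>P) * d) + (c + int i * d) \<in> defect_sums (ap h)"
    if "i < h" "i \<notin> P"
    unfolding *[symmetric] using assms that d by (intro defect_sums_oddI image_mono) auto
qed

text \<open>For c = d the sums take the values 0 to 20 times d; the two optional entries of the list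
  below are new values that split a unit step.\<close>

lemma card_defect_sums_ap_4: "21 + of_bool (c \<noteq> d) \<le> card (defect_sums (ap 4))"
proof -
  let ?D = "defect_sums (ap 4)"
  let ?L = "[0, c] @ (if c < d then [2 * c] else []) @ [c + d, c + 2 * d] @
    (if d < c then [c + 3 * d] else []) @
    [2 * c + 2 * d, 3 * c + 2 * d, 3 * c + 3 * d, 3 * c + 4 * d, 4 * c + 4 * d,
     5 * c + 4 * d, 5 * c + 5 * d, 5 * c + 6 * d, 5 * c + 7 * d, 5 * c + 8 * d, 5 * c + 9 * d,
     5 * c + 10 * d, 6 * c + 10 * d, 7 * c + 10 * d, 7 * c + 11 * d, 7 * c + 12 * d,
     8 * c + 12 * d]"
  note e = defect_sums_apI(1)[of _ 4] and o = defect_sums_apI(2)[of _ 4]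
  have ev: "0 \<in> ?D" "2 * c \<in> ?D" "2 * c + 2 * d \<in> ?D" "4 * c + 4 * d \<in> ?D"
    "6 * c + 10 * d \<in> ?D" "8 * c + 12 * d \<in> ?D"
    using e[of "{}"] e[of "{0}"] e[of "{1}"] e[of "{0, 2}"] e[of "{0, 2, 3}"] e[of "{0, 1, 2, 3}"]
    by (simp_all add: algebra_simps)
  have od1: "c \<in> ?D" "c + d \<in> ?D" "c + 2 * d \<in> ?D" "c + 3 * d \<in> ?D"
    using o[of "{}" 0] o[of "{}" 1] o[of "{}" 2] o[of "{}" 3] by (simp_all add: algebra_simps)
  have od3: "3 * c + 2 * d \<in> ?D" "3 * c + 3 * d \<in> ?D" "3 * c + 4 * d \<in> ?D"
    using o[of "{0}" 2] o[of "{0}" 3] o[of "{1}" 2] by (simp_all add: algebra_simps)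
  have od5: "5 * c + 4 * d \<in> ?D" "5 * c + 5 * d \<in> ?D" "5 * c + 6 * d \<in> ?D" "5 * c + 7 * d \<in> ?D"
    "5 * c + 8 * d \<in> ?D" "5 * c + 9 * d \<in> ?D" "5 * c + 10 * d \<in> ?D"
    using o[of "{0, 1}" 2] o[of "{0, 1}" 3] o[of "{1, 2}" 0] o[of "{0, 2}" 3] o[of "{0, 3}" 2]
      o[of "{1, 2}" 3] o[of "{1, 3}" 2]
    by (simp_all add: algebra_simps)
  have od7: "7 * c + 10 * d \<in> ?D" "7 * c + 11 * d \<in> ?D" "7 * c + 12 * d \<in> ?D"
    using o[of "{0, 1, 3}" 2] o[of "{0, 2, 3}" 1] o[of "{1, 2, 3}" 0]
    by (simp_all add: algebra_simps)
  have "set ?L \<subseteq> ?D" using ev od1 od3 od5 od7 by auto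
  then have "card (set ?L) \<le> card ?D" by (intro card_mono finite_defect_sums) auto
  \<comment> \<open>Consecutive entries differ by \<open>c\<close> or \<open>d\<close>, except after
    an optional entry, where they differ by \<open>d - c\<close> or \<open>c - d\<close>, positive
    exactly when that entry is present.\<close>
  moreover have "sorted_wrt (<) ?L" using c d by simp
  then have "distinct ?L" using strict_sorted_iff by blast
  then have "card (set ?L) = length ?L" by (rule distinct_card)
  moreover have "length ?L = 21 + of_bool (c \<noteq> d)" by simp
  ultimately show ?thesis by simp
qed

text \<open>Taking term \<open>i\<close> once and term \<open>j\<close> twice gives
  \<open>v = i + 2 * j\<close>. Small \<open>v\<close> uses \<open>j = 0\<close>; larger
  \<open>v\<close> uses \<open>i = 0\<close> or \<open>i = 1\<close> according to parity. The value
  \<open>v = 0\<close> would need \<open>i = j\<close>.\<close>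

lemma defect_sums_ap_triple:
  assumes "3 \<le> h" "1 \<le> v" "v < 2 * h"
  shows "3 * c + int v * d \<in> defect_sums (ap (Suc h))"
proof -
  have *: "3 * c + int (i + 2 * j) * d \<in> defect_sums (ap (Suc h))"
    if "i \<le> h" "j \<le> h" "i \<noteq> j" for i j
    using defect_sums_apI(2)[of "{j}" "Suc h" i] that by (simp add: algebra_simps)
  consider "v \<le> h" | "h < v" "even v" | "h < v" "odd v" by linarith
  then show ?thesis
  proof cases
    case 1
    then show ?thesis using *[of v 0] assms by simp
  next
    case 2
    then show ?thesis using *[of 0 "v div 2"] assms by simp
  next
    case 3
    then obtain w where "v = 2 * w + 1" by (auto elim: oddE)
    then show ?thesis using *[of 1 w] 3 assms by simp
  qed
qed

lemma defect_sums_ap_double: "i < h \<Longrightarrow> 2 * (c + int i * d) \<in> defect_sums (ap h)"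
  using defect_sums_apI(1)[of "{i}" h] by simp

text \<open>Besides \<open>0\<close> and the \<open>h + 1\<close> terms themselves, the step from
  \<open>h\<close> to \<open>h + 1\<close> needs \<open>h\<close> more sums below twice the last
  term. Which sums fall between the last term and its double depends on how \<open>c\<close>
  compares with \<open>int h * d\<close>.\<close>

lemma defect_sums_ap_between:
  assumes "3 \<le> h"
  obtains V where "V \<subseteq> defect_sums (ap (Suc h))" "card V = h"
    "V \<subseteq> {c + int h * d <..< 2 * (c + int h * d)}"
proof -
  define b where "b = c + int h * d"
  have inj1: "inj_on (\<lambda>v. 3 * c + int v * d) X" and inj2: "inj_on (\<lambda>v. 2 * (c + int v * d)) X" for X
    using d by (auto intro!: inj_onI)
  consider "c < int h * d" | "c = int h * d" | "int h * d < c" by linarith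
  then show thesis
  proof cases
    case 1
    \<comment> \<open>The least positive index whose value \<open>3 * c + int v0 * d\<close> exceeds
      the last term. The upper bound keeps the block of \<open>h\<close> consecutive values starting
      there below twice the last term.\<close>
    obtain v0 :: nat where v0: "1 \<le> v0" "int h * d - 2 * c < int v0 * d" "int v0 * d < int h * d + d - c"
    proof (cases "int h * d - 2 * c < 0")
      case True
      then show thesis using that[of 1] 1 d by auto
    next
      case False
      define q where "q = nat ((int h * d - 2 * c) div d)"
      have q: "int q = (int h * d - 2 * c) div d"
        unfolding q_def using False d by (simp add: pos_imp_zdiv_nonneg_iff)
      have "int h * d - 2 * c = int q * d + (int h * d - 2 * c) mod d"
        unfolding q by simp
      moreover have "0 \<le> (int h * d - 2 * c) mod d" "(int h * d - 2 * c) mod d < d" using d by auto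
      ultimately show thesis using that[of "Suc q"] c by (auto simp: algebra_simps)
    qed
    have vb: "int v * d \<le> int v0 * d + (int h - 1) * d" if "v \<in> {v0..<v0 + h}" for v
    proof -
      have "int v \<le> int v0 + (int h - 1)" using that assms by auto
      then have "int v * d \<le> (int v0 + (int h - 1)) * d" using d by (intro mult_right_mono) auto
      then show ?thesis by (simp add: algebra_simps)
    qed
    have va: "int v0 * d \<le> int v * d" if "v \<in> {v0..<v0 + h}" for v
      using that d by (intro mult_right_mono) auto
    show thesis
    proof (rule that[of "(\<lambda>v. 3 * c + int v * d) ` {v0..<v0 + h}"])
      show "card ((\<lambda>v. 3 * c + int v * d) ` {v0..<v0 + h}) = h" by (simp add: card_image inj1)
      show "(\<lambda>v. 3 * c + int v * d) ` {v0..<v0 + h} \<subseteq> {c + int h * d <..< 2 * (c + int h * d)}"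
      proof clarsimp
        fix v assume "v0 \<le> v" "v < v0 + h"
        then show "int h * d < 2 * c + int v * d \<and> c + int v * d < 2 * (int h * d)"
          using va[of v] vb[of v] v0 by (auto simp: algebra_simps)
      qed
      have "v < 2 * h" if "v \<in> {v0..<v0 + h}" for v
      proof -
        have "int v * d < int (2 * h) * d" using vb[OF that] v0 c by (simp add: algebra_simps)
        then show ?thesis using d by simp
      qed
      then show "(\<lambda>v. 3 * c + int v * d) ` {v0..<v0 + h} \<subseteq> defect_sums (ap (Suc h))"
        using v0(1) assms defect_sums_ap_triple by fastforce
    qed
  next
    case 2
    \<comment> \<open>The values \<open>3 * c + int v * d\<close> provide only \<open>h - 1\<close>
      sums here, as \<open>v = h\<close> would hit the excluded upper end \<open>4 * c\<close>. The
      missing one is \<open>2 * (c + d)\<close>, which lies below \<open>3 * c\<close> because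
      \<open>3 * d \<le> c\<close>.\<close>
    let ?V = "insert (2 * (c + int 1 * d)) ((\<lambda>v. 3 * c + int v * d) ` {1..<h})"
    have c3: "3 * d \<le> c" unfolding 2 using assms d by (intro mult_right_mono) auto
    show thesis
    proof (rule that[of ?V])
      have b1: "d \<le> int v * d" "int v * d < c" if "v \<in> {1..<h}" for v
        using that d mult_right_mono[of 1 "int v" d] 2 by auto
      have "2 * (c + int 1 * d) \<notin> (\<lambda>v. 3 * c + int v * d) ` {1..<h}"
      proof
        assume "2 * (c + int 1 * d) \<in> (\<lambda>v. 3 * c + int v * d) ` {1..<h}"
        then obtain v where v: "v \<in> {1..<h}" and "2 * (c + d) = 3 * c + int v * d" by auto
        then have "int v * d = 2 * d - c" by simp
        then show False using b1(1)[OF v] c3 d by simp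
      qed
      then show "card ?V = h" using assms by (simp add: card_image inj1)
      have "3 * c + int v * d \<in> {c + c <..< 2 * (c + c)}" if "v \<in> {1..<h}" for v
      proof -
        have "0 < c + int v * d" using c d by (intro add_pos_nonneg) auto
        then show ?thesis using b1(2)[OF that] by simp
      qed
      then show "?V \<subseteq> {c + int h * d <..< 2 * (c + int h * d)}"
        unfolding 2[symmetric] using c3 d by auto
      have "3 * c + int v * d \<in> defect_sums (ap (Suc h))" if "v \<in> {1..<h}" for v
        using that assms by (intro defect_sums_ap_triple) auto
      moreover have "2 * (c + int 1 * d) \<in> defect_sums (ap (Suc h))"
        using assms by (intro defect_sums_ap_double) auto
      ultimately show "?V \<subseteq> defect_sums (ap (Suc h))" by blast
    qed
  next
    case 3
    \<comment> \<open>Now \<open>2 * c\<close> already exceeds the last term, so the doubled terms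
      suffice.\<close>
    show thesis
    proof (rule that[of "(\<lambda>v. 2 * (c + int v * d)) ` {..<h}"])
      show "card ((\<lambda>v. 2 * (c + int v * d)) ` {..<h}) = h" by (subst card_image[OF inj2]) simp
      show "(\<lambda>v. 2 * (c + int v * d)) ` {..<h} \<subseteq> {c + int h * d <..< 2 * (c + int h * d)}"
      proof (rule image_subsetI)
        fix v assume "v \<in> {..<h}"
        then have "0 \<le> int v * d" "int v * d < int h * d" using d by auto
        then show "2 * (c + int v * d) \<in> {c + int h * d <..< 2 * (c + int h * d)}"
          using 3 unfolding greaterThanLessThan_iff distrib_left by linarith
      qed
      show "(\<lambda>v. 2 * (c + int v * d)) ` {..<h} \<subseteq> defect_sums (ap (Suc h))"
        using defect_sums_ap_double[of _ "Suc h"] by (intro image_subsetI) simp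
    qed
  qed
qed

lemma card_defect_sums_ap_Suc:
  assumes "3 \<le> h"
  shows "card (defect_sums (ap h)) + 2 * (h + 1) \<le> card (defect_sums (ap (Suc h)))"
proof -
  obtain V where V: "V \<subseteq> defect_sums (ap (Suc h))" "card V = h"
    "V \<subseteq> {c + int h * d <..< 2 * (c + int h * d)}"
    using defect_sums_ap_between[OF assms] .
  have le: "int i * d \<le> int h * d" "0 \<le> int i * d" if "i \<le> h" for i
    using that d by (auto intro!: mult_right_mono)
  have ins: "ap (Suc h) = insert (c + int h * d) (ap h)" by (simp add: lessThan_Suc)
  have finV: "finite V" using V(3) finite_subset by blast
  \<comment> \<open>In number \<open>1 + (h + 1) + h\<close>, which is the growth of
    \<open>h * (h + 1) + 1\<close> from \<open>h\<close> to \<open>h + 1\<close>.\<close>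
  let ?N = "insert 0 (ap (Suc h) \<union> V)"
  have "card (ap (Suc h)) = Suc h" using d by (subst card_image) (auto intro: inj_onI)
  moreover have "ap (Suc h) \<inter> V = {}" using V(3) le by (force simp: less_Suc_eq_le)
  moreover have "0 \<notin> ap (Suc h) \<union> V" using V(3) le c by (force simp: less_Suc_eq_le)
  ultimately have "card ?N = 2 * (h + 1)" using V(2) finV by (simp add: card_Un_disjoint)
  moreover have "card (defect_sums (ap h)) + card ?N \<le> card (defect_sums (insert (c + int h * d) (ap h)))"
  proof (rule card_defect_sums_insert)
    show "c + int h * d \<notin> ap h" using d by auto
    have "x \<in> defect_sums (ap (Suc h))" if "x \<in> ap (Suc h)" for x
      using defect_sums_oddI[of "{}" "ap (Suc h)" x] that by simp
    moreover have "0 \<in> defect_sums (ap (Suc h))"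
      using defect_sums_evenI[of "{}" "ap (Suc h)"] by simp
    ultimately show "?N \<subseteq> defect_sums (insert (c + int h * d) (ap h))"
      using V(1) unfolding ins[symmetric] by blast
    show "0 \<le> x" if "x \<in> insert (c + int h * d) (ap h)" for x
      using that c d by auto
    show "y < 2 * (c + int h * d)" if "y \<in> ?N" for y
    proof -
      have "x < 2 * (c + int h * d)" if "x \<in> ap (Suc h)" for x
      proof -
        from that obtain i where i: "i < Suc h" "x = c + int i * d" by blast
        then show ?thesis using le[of i] le[of h] c by simp
      qed
      moreover have "0 < 2 * (c + int h * d)" using c le[of h] by simp
      ultimately show ?thesis using that V(3) by auto
    qed
  qed simp
  ultimately show ?thesis unfolding ins by simp
qed

text \<open>Each step gains at least the growth of \<open>h * (h + 1) + 1\<close>, so the extra sum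
  found for \<open>c \<noteq> d\<close> at \<open>h = 4\<close> persists.\<close>

lemma card_defect_sums_ap:
  assumes "4 \<le> h"
  shows "h * (h + 1) + 1 + of_bool (c \<noteq> d) \<le> card (defect_sums (ap h))"
  using assms
proof (induction h rule: dec_induct)
  case base
  then show ?case using card_defect_sums_ap_4 by simp
next
  case (step h)
  then show ?case using card_defect_sums_ap_Suc[of h] by simp
qed

end

subsection \<open>The three parts of the signed sumset\<close>

text \<open>The outer two parts lie beyond the inner one and meet it in one point each.\<close>

lemma card_signed_sumset_ge:
  assumes "finite A" "B \<subseteq> A" "A' \<subseteq> A" "\<And>x. x \<in> B \<Longrightarrow> 0 \<le> x" "0 < \<Sum>B"
    and inner: "\<Sum>B \<in> restricted_signed_sumset h B"
    and outer: "\<Sum>B \<in> restricted_sumset h A'"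
      "\<And>s. s \<in> restricted_sumset h A' \<Longrightarrow> \<Sum>B \<le> s"
  defines "U \<equiv> uminus ` restricted_sumset h A' \<union> restricted_signed_sumset h B \<union> restricted_sumset h A'"
  shows "U \<subseteq> restricted_signed_sumset h A"
    and "card U + 2 = 2 * card (restricted_sumset h A') + card (restricted_signed_sumset h B)"
proof -
  let ?R = "restricted_sumset h A'" and ?S = "restricted_signed_sumset h B"
  let ?O = "?R - {\<Sum>B}"
  have fin: "finite A'" "finite B" using assms(1-3) finite_subset by auto
  have abs: "\<bar>s\<bar> \<le> \<Sum>B" if "s \<in> ?S" for s
    using restricted_signed_sumset_abs_le[OF fin(2) assms(4) that] .
  have finR: "finite ?R" and finS: "finite ?S"
    using fin finite_restricted_sumset finite_restricted_signed_sumset by auto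
  show "U \<subseteq> restricted_signed_sumset h A"
    unfolding U_def
    using restricted_sumset_subset_signed[OF assms(1,3)] restricted_signed_sumset_mono[OF assms(1,2)]
      restricted_signed_sumset_uminus[OF assms(1)] by blast
  have O: "\<Sum>B < s" if "s \<in> ?O" for s using outer(2) that by force
  have "U = uminus ` ?O \<union> ?S \<union> ?O"
    unfolding U_def using inner restricted_signed_sumset_uminus[OF fin(2) inner] by auto
  moreover have "?S \<inter> ?O = {}" using abs O by (meson abs_le_D1 disjoint_iff not_le)
  moreover have O_neg: "s < - \<Sum>B" if "s \<in> uminus ` ?O" for s
    using that O by (metis imageE neg_less_iff_less)
  then have "uminus ` ?O \<inter> ?S = {}" using abs by (meson abs_le_D2 disjoint_iff minus_le_iff not_le)
  moreover have "uminus ` ?O \<inter> ?O = {}"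
    using O O_neg assms(5) by (meson disjoint_iff less_trans neg_less_0_iff_less not_less_iff_gr_or_eq)
  moreover have "card (uminus ` ?O) = card ?O" by (intro card_image) (auto intro: inj_onI)
  ultimately have "card U = 2 * card ?O + card ?S"
    using finR finS by (simp add: card_Un_disjoint Int_Un_distrib2)
  moreover have "card ?R = Suc (card ?O)" by (rule card.remove[OF finR outer(1)])
  ultimately show "card U + 2 = 2 * card ?R + card ?S" by simp
qed

section \<open>Recovering the progression from the sizes of the three parts\<close>

theorem theorem2p8:
  fixes h k :: nat and a :: "nat \<Rightarrow> int" and A A\<^sub>h A' :: "int set"
  assumes "4 \<le> h" and "h \<le> k - 1"
    and "a 0 = 0" and "strict_mono_on {..<k} a"
    and "A = a ` {..<k}" and "A\<^sub>h = a ` {..h}" and "A' = A - {a 0}"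
    and "int (card (restricted_signed_sumset h A)) =
           2 * int h * int k - int h * (int h + 1) + 1"
    and "arith_progression A
       \<or> arith_progression A\<^sub>h
       \<or> (card (restricted_signed_sumset h A\<^sub>h) \<ge> h * (h + 1) + 1 \<and> 4 \<le> h \<and> h \<le> k - 3)
       \<or> (restricted_signed_sumset h A =
            restricted_sumset h (uminus ` A') \<union> restricted_signed_sumset h A\<^sub>h
              \<union> restricted_sumset h A'
          \<and> arith_progression A')
       \<or> (card (restricted_signed_sumset h A\<^sub>h) \<ge> h * (h + 1) + 1 \<and> arith_progression A')"
  shows "A = dilate (a 1) {0..int k - 1}"
proof -
  define n where "n = k - 1"
  define b where "b i = a (Suc i)" for i
  have k: "k = Suc n" and hn: "h \<le> n" using assms(1,2) by (auto simp: n_def)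
  have inj: "inj_on a {..<k}" by (rule strict_mono_on_imp_inj_on[OF assms(4)])
  have a_less: "a i < a j" if "i < j" "j < k" for i j
    using strict_mono_onD[OF assms(4)] that by auto
  have mono_b: "strict_mono_on {..<n} b"
    by (rule strict_mono_onI) (auto simp: b_def k intro: a_less)
  have b_pos: "0 < b i" if "i < n" for i
    using a_less[of 0 "Suc i"] that assms(3) by (simp add: b_def k)
  have zero_notin: "0 \<notin> b ` {..<m}" if "m \<le> n" for m
    using b_pos that by (auto simp: image_iff) (metis less_irrefl order_less_le_trans)
  have split: "a ` {..<Suc m} = insert 0 (b ` {..<m})" for m
    unfolding lessThan_Suc_eq_insert_0 using assms(3) by (simp add: b_def image_image)
  have A: "A = insert 0 (b ` {..<n})" using split[of n] assms(5) k by simp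
  have A': "A' = b ` {..<n}" using A zero_notin[of n] assms(3,7) by auto
  have Ah: "A\<^sub>h = insert 0 (b ` {..<h})" using split[of h] assms(6) by (simp add: lessThan_Suc_atMost)
  have finA: "finite A" and finAh: "finite A\<^sub>h" and subAh: "A\<^sub>h \<subseteq> A" and subA': "A' \<subseteq> A"
    using A A' Ah hn by auto
  have inj_b: "inj_on b {..<n}" by (rule strict_mono_on_imp_inj_on[OF mono_b])
  have inj_bh: "inj_on b {..<h}" by (rule inj_on_subset[OF inj_b]) (use hn in auto)
  have card_bh: "card (b ` {..<h}) = h" using inj_bh by (simp add: card_image)
  have sumAh: "\<Sum>A\<^sub>h = sum b {..<h}" unfolding Ah using zero_notin[OF hn] inj_bh by (simp add: sum.reindex)
  \<comment> \<open>The common target of all cases: the difference of \<open>A'\<close> equals its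
    first term, so that \<open>0\<close> continues the progression.\<close>
  have linear_imp: ?thesis if "\<And>i. i < n \<Longrightarrow> b i = b 0 + int i * b 0"
  proof -
    have "a i = a 1 * int i" if "i < k" for i
      using \<open>\<And>i. i < n \<Longrightarrow> b i = b 0 + int i * b 0\<close>[of "i - 1"] that assms(3) k
      by (cases i) (auto simp: b_def algebra_simps)
    then have "A = (\<lambda>i. a 1 * int i) ` {..<k}" unfolding assms(5) by (intro image_cong) auto
    also have "\<dots> = (*) (a 1) ` int ` {..<k}" by (simp add: image_image)
    also have "int ` {..<k} = {0..int k - 1}"
      using image_int_atLeastLessThan[of 0 k] by (auto simp: atLeast0LessThan)
    finally show ?thesis unfolding dilate_def .
  qed
  let ?S = "restricted_signed_sumset h A" and ?Sh = "restricted_signed_sumset h A\<^sub>h"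
    and ?R = "restricted_sumset h A'"
  let ?U = "uminus ` ?R \<union> ?Sh \<union> ?R"
  have R: "?R = {sum b I | I. I \<subseteq> {..<n} \<and> card I = h}"
    unfolding A' by (rule restricted_sumset_image[OF inj_b])
  have inner: "\<Sum>A\<^sub>h \<in> ?Sh"
    unfolding restricted_signed_sumset_eq[OF finAh]
    by (intro CollectI exI[of _ "b ` {..<h}"] exI[of _ "{}"])
      (use card_bh sumAh Ah inj_bh in \<open>auto simp: sum.reindex\<close>)
  have nonneg: "0 \<le> x" if "x \<in> A\<^sub>h" for x
  proof (cases "x = 0")
    case False
    then obtain i where "i < h" "x = b i" using \<open>x \<in> A\<^sub>h\<close> unfolding Ah by auto
    then show ?thesis using b_pos[of i] hn by simp
  qed simp
  have U: "?U \<subseteq> ?S" "card ?U + 2 = 2 * card ?R + card ?Sh"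
  proof -
    have pos: "0 < \<Sum>A\<^sub>h" unfolding sumAh using assms(1) hn b_pos by (intro sum_pos) (auto simp: lessThan_empty_iff)
    have o1: "\<Sum>A\<^sub>h \<in> ?R" unfolding R sumAh using hn by (intro CollectI exI[of _ "{..<h}"]) auto
    have o2: "\<Sum>A\<^sub>h \<le> s" if "s \<in> ?R" for s
      using that sum_rank_ge(1)[OF mono_b] unfolding R sumAh by auto
    show "?U \<subseteq> ?S" "card ?U + 2 = 2 * card ?R + card ?Sh"
      using card_signed_sumset_ge[OF finA subAh subA' nonneg pos inner o1 o2] by auto
  qed
  have finS: "finite ?S" by (rule finite_restricted_signed_sumset[OF finA])
  have "int (card ?S + h * (h + 1)) = int (2 * h * (n + 1) + 1)"
    using assms(8) k by (simp add: algebra_simps)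
  then have cardS: "card ?S + h * (h + 1) = 2 * h * (n + 1) + 1" by (simp only: of_nat_eq_iff)
  have cardR: "h * (n - h) + 1 \<le> card ?R"
    unfolding A' by (rule card_restricted_sumset_ge[OF mono_b hn])
  have hn_eq: "h * n = h * (n - h) + h * h" using hn by (simp add: diff_mult_distrib2)
  have cardUS: "card ?U \<le> card ?S" by (rule card_mono[OF finS U(1)])
  have cardSh: "card ?Sh \<le> h * (h + 1) + 1"
  proof -
    have "2 * h * (n + 1) = 2 * (h * (n - h)) + 2 * (h * h) + 2 * h"
      using hn_eq by (simp add: algebra_simps)
    then show ?thesis using cardUS U(2) cardS cardR by (simp only: distrib_left)
  qed
  have A'_case: ?thesis if "\<And>i. i < n \<Longrightarrow> b i = b 0 + int i * d" "0 < d" for d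
  proof (rule linear_imp)
    have img: "b ` {..<h} = (\<lambda>i. b 0 + int i * d) ` {..<h}"
      by (intro image_cong refl that(1)) (use hn in simp)
    have "h * (h + 1) + 1 + of_bool (b 0 \<noteq> d) \<le> card (defect_sums (b ` {..<h}))"
      unfolding img using card_defect_sums_ap[OF _ that(2) assms(1)] b_pos[of 0] assms(1) hn by simp
    also have "\<dots> \<le> card ?Sh"
      using card_defect_sums_le[of "b ` {..<h}"] zero_notin[OF hn] card_bh Ah by simp
    \<comment> \<open>A first term other than \<open>d\<close> would produce one sum more than
      \<open>cardSh\<close> permits.\<close>
    finally have "b 0 = d" using cardSh by (auto simp: of_bool_def split: if_splits)
    then show "b i = b 0 + int i * b 0" if "i < n" for i
      using \<open>\<And>i. i < n \<Longrightarrow> b i = b 0 + int i * d\<close>[OF that] by simp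
  qed
  have large_case: ?thesis if "h * (h + 1) + 1 \<le> card ?Sh" "h + 2 \<le> n"
  proof (rule A'_case)
    have min: "card (restricted_sumset h (b ` {..<n})) \<le> h * (n - h) + 1"
      using cardUS U(2) cardS hn_eq that(1) unfolding A'[symmetric] by (simp add: algebra_simps)
    show "b i = b 0 + int i * (b 1 - b 0)" if "i < n" for i
      using minimal_imp_linear[OF mono_b _ \<open>h + 2 \<le> n\<close> _ min that] assms(1) \<open>h + 2 \<le> n\<close> by simp
    show "0 < b 1 - b 0" using strict_mono_onD[OF mono_b, of 0 1] that(2) by simp
  qed
  consider (A) "arith_progression A" | (Ah) "arith_progression A\<^sub>h"
    | (c) "h * (h + 1) + 1 \<le> card ?Sh" "h \<le> k - 3"
    | (A') "arith_progression A'" using assms(9) by blast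
  then show ?thesis
  proof cases
    case A
    then obtain d where d: "0 < d" "\<And>i. i < k \<Longrightarrow> a i = a 0 + int i * d"
      using arith_progression_image[OF assms(4)] assms(5) by blast
    show ?thesis
    proof (rule linear_imp)
      fix i assume "i < n"
      then show "b i = b 0 + int i * b 0"
        using d(2)[of 1] d(2)[of "Suc i"] assms(3) by (simp add: b_def k algebra_simps)
    qed
  next
    case A'
    then show ?thesis using arith_progression_image[OF mono_b] A'_case \<open>A' = b ` {..<n}\<close> by metis
  next
    case c
    then show ?thesis using large_case k assms(1) by simp
  next
    case Ah
    have "strict_mono_on {..<Suc h} a"
      by (rule monotone_on_subset[OF assms(4)]) (use hn k in auto)
    then obtain d where d: "0 < d" "\<And>i. i < Suc h \<Longrightarrow> a i = a 0 + int i * d"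
      using arith_progression_image Ah assms(6) unfolding lessThan_Suc_atMost[symmetric] by blast
    have b: "b i = d + int i * d" if "i < h" for i
      using d(2)[of "Suc i"] that assms(3) by (simp add: b_def algebra_simps)
    have img: "b ` {..<h} = (\<lambda>i. d + int i * d) ` {..<h}"
      by (intro image_cong) (use b in auto)
    \<comment> \<open>Since \<open>A\<^sub>h\<close> starts at \<open>0\<close>, its nonzero part
      has first term and difference both \<open>d\<close>; the count with \<open>c = d\<close> makes
      the middle part full.\<close>
    have "h * (h + 1) + 1 \<le> card (defect_sums (b ` {..<h}))"
      unfolding img using card_defect_sums_ap[OF d(1) d(1) assms(1)] by simp
    also have "\<dots> \<le> card ?Sh"
      using card_defect_sums_le[of "b ` {..<h}"] zero_notin[OF hn] card_bh Ah \<open>A\<^sub>h = insert 0 (b ` {..<h})\<close> by simp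
    finally have Sh: "h * (h + 1) + 1 \<le> card ?Sh" .
    consider "h + 2 \<le> n" | "n = h" | "n = Suc h" using hn by linarith
    then show ?thesis
    proof cases
      case 1
      then show ?thesis using large_case Sh by blast
    next
      case 2
      then show ?thesis using linear_imp b b[of 0] assms(1) by simp
    next
      case 3
      \<comment> \<open>With one element beyond \<open>A\<^sub>h\<close>, too few gaps can be
        compared. Instead, the lower bounds for the parts already add up to the prescribed size, so
        the three parts exhaust \<open>?S\<close>.\<close>
      have "card ?S \<le> card ?U" using U(2) cardS cardR hn_eq Sh 3 by (simp add: algebra_simps)
      then have "?U = ?S" using card_seteq[OF finS U(1)] by simp
      define T where "T = sum b {..<h}"
      have bh: "int h * d < b h"
        using a_less[of h "Suc h"] d(2)[of h] assms(3) 3 by (simp add: b_def k)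
      \<comment> \<open>In the sum \<open>T\<close>, the terms \<open>b 0 = d\<close> and
        \<open>b (h - 1) = int h * d\<close> are exchanged for \<open>b h\<close> and
        \<open>0\<close>. So \<open>x - T\<close> is the deviation of \<open>b h\<close> from its
        expected value \<open>(int h + 1) * d\<close>.\<close>
      define x where "x = T + b h - int h * d - d"
      have "x \<in> ?S"
      proof -
        let ?I = "insert h ({..<h} - {0, h - 1})"
        have "card ({..<h} - {0, h - 1}) = h - 2"
          using assms(1) by (subst card_Diff_subset) auto
        moreover have "{..<h} = insert 0 (insert (h - 1) ({..<h} - {0, h - 1}))"
          using assms(1) by auto
        moreover have "T = b 0 + (b (h - 1) + sum b ({..<h} - {0, h - 1}))"
          unfolding T_def by (subst calculation(2)) (use assms(1) in simp)
        ultimately have I: "card ?I = h - 1" "sum b ?I = x"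
          using assms(1) b[of 0] b[of "h - 1"] by (auto simp: x_def algebra_simps of_nat_diff)
        have I_sub: "?I \<subseteq> {..<n}" using 3 by auto
        have "0 \<notin> b ` ?I" using zero_notin[of n] I_sub by blast
        moreover have "card (b ` ?I) = h - 1" "\<Sum>(b ` ?I) = x"
          using inj_on_subset[OF inj_b I_sub] I by (auto simp only: card_image sum.reindex o_def id_def)
        ultimately have "insert 0 (b ` ?I) \<subseteq> A" "card (insert 0 (b ` ?I)) = h"
          "\<Sum>(insert 0 (b ` ?I)) = x"
          using A I_sub assms(1) by auto
        then show ?thesis unfolding restricted_signed_sumset_eq[OF finA]
          by (intro CollectI exI[of _ "insert 0 (b ` ?I)"] exI[of _ "{}"]) auto
      qed
      \<comment> \<open>A sum of \<open>h\<close> of the \<open>h + 1\<close> elements omits just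
        one \<open>b i\<close>. Omitting \<open>b h\<close> gives \<open>T\<close>; the next
        smallest value omits \<open>b (h - 1)\<close> and is \<open>x + d\<close>. Thus
        \<open>x\<close> can be in \<open>?R\<close> only as \<open>T\<close>.\<close>
      have R_vals: "s = T \<or> T + b h - int h * d \<le> s" if "s \<in> ?R" for s
      proof -
        obtain I where I: "I \<subseteq> {..<Suc h}" "card I = h" "s = sum b I"
          using \<open>s \<in> ?R\<close> R 3 by auto
        have "card ({..<Suc h} - I) = 1" using I(1,2) finite_subset[OF I(1)] by (simp add: card_Diff_subset)
        then obtain i where i: "{..<Suc h} - I = {i}" by (auto simp: card_1_singleton_iff)
        then have "i \<le> h" "I = {..<Suc h} - {i}" using I(1) by auto
        then have s: "s = T + b h - b i" unfolding I(3) T_def by (simp add: sum_diff1)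
        show ?thesis
        proof (cases "i = h")
          case False
          then have "i < h" using \<open>i \<le> h\<close> by simp
          then have "int (Suc i) * d \<le> int h * d" using d(1) by (intro mult_right_mono) auto
          then show ?thesis using s b[OF \<open>i < h\<close>] by (simp add: algebra_simps)
        qed (use s in simp)
      qed
      have dvd: "d dvd s" if "s \<in> ?Sh" for s
      proof -
        obtain P Q where PQ: "P \<subseteq> A\<^sub>h" "Q \<subseteq> A\<^sub>h" "s = \<Sum>P - \<Sum>Q"
          using \<open>s \<in> ?Sh\<close> restricted_signed_sumset_eq[OF finAh] by auto
        have "d dvd y" if "y \<in> A\<^sub>h" for y
          using that Ah b unfolding \<open>A\<^sub>h = insert 0 (b ` {..<h})\<close> by auto
        then show ?thesis using PQ by (auto intro!: dvd_diff dvd_sum)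
      qed
      have Sh_le: "s \<le> T" if "s \<in> ?Sh" for s
      proof -
        from restricted_signed_sumset_abs_le[OF finAh nonneg that] show ?thesis
          using sumAh T_def by simp
      qed
      have T_mem: "T \<in> ?Sh" using inner sumAh T_def by simp
      \<comment> \<open>This makes \<open>x\<close> positive, hence keeps it out of the negative
        outer part.\<close>
      have T_gt: "d < T"
      proof -
        have "T = sum b {0, 1} + sum b ({..<h} - {0, 1})"
          unfolding T_def using assms(1) by (subst sum.subset_diff[of "{0, 1}"]) auto
        moreover have "0 \<le> sum b ({..<h} - {0, 1})"
          by (intro sum_nonneg less_imp_le[OF b_pos]) (use hn in auto)
        ultimately show ?thesis using b[of 0] b[of 1] d(1) assms(1) by simp
      qed
      have "x \<in> ?Sh"
      proof -
        have "x \<notin> uminus ` ?R"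
        proof
          assume "x \<in> uminus ` ?R"
          then obtain s where "s \<in> ?R" "x = - s" by blast
          then have "x \<le> - T" using R_vals[of s] bh by auto
          then show False using T_gt bh d(1) unfolding x_def by linarith
        qed
        moreover have "x = T" if "x \<in> ?R" using R_vals[OF that] d(1) by (simp add: x_def)
        ultimately show ?thesis using \<open>x \<in> ?S\<close> \<open>?U = ?S\<close> T_mem by blast
      qed
      \<comment> \<open>Membership of \<open>x\<close> in the middle part bounds the last gap by
        \<open>d\<close> and makes it a multiple of \<open>d\<close>; being positive, it equals
        \<open>d\<close>.\<close>
      then have "b h - int h * d \<le> d" using Sh_le by (force simp: x_def)
      moreover have "d dvd b h - int h * d"
      proof -
        have "d dvd (x - T) + d" using dvd \<open>x \<in> ?Sh\<close> T_mem by (intro dvd_add dvd_diff) auto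
        then show ?thesis by (simp add: x_def algebra_simps)
      qed
      ultimately have "b h - int h * d = d" using bh zdvd_imp_le by fastforce
      then have "b i = d + int i * d" if "i < n" for i
        using b[of i] that 3 by (cases "i = h") auto
      then show ?thesis using linear_imp 3 by simp
    qed
  qed
qed

end
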